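(* Let $r\ge 3$, $k\ge 1$ and $n\ge 1$ be integers. Then $$ex_r^{\mathrm{lin}}(n,S_k^r)\le \frac{n(k-1)}{r}.$$ Moreover, equality is characterized as follows: a linear $r$-uniform hypergraph $H$ on $n$ vertices is $S_k^r$-free with $|E(H)|=\frac{n(k-1)}{r}$ if and only if $H$ is $(k-1)$-regular (so equality is attained exactly when an $n$-vertex linear $r$-uniform $(k-1)$-regular hypergraph exists).
   Context: All hypergraphs are finite. A hypergraph is $r$-uniform if each hyperedge has exactly $r$ vertices, and linear if any two distinct hyperedges intersect in at most one vertex. The degree $d(v)$ of a vertex is the number of hyperedges containing it; $H$ is $d$-regular if every vertex has degree $d$. A hypergraph $H$ contains $F$ as a subhypergraph if there is an injective map $V(F)\to V(H)$ sending every hyperedge of $F$ to a hyperedge of $H$; otherwise $H$ is $F$-free. The linear Turán number $ex_r^{\mathrm{lin}}(n,F)$ is the maximum number of hyperedges in an $F$-free linear $r$-uniform hypergraph on $n$ vertices. The expansion $G^r$ of a graph $G$ is the $r$-uniform hypergraph obtained by enlarging each edge of $G$ with $r-2$ new vertices, the new vertices for different edges being distinct. $S_k$ is the star with $k$ edges and $S_k^r$ is its expansion, i.e. $k$ hyperedges of size $r$ sharing one common vertex and otherwise pairwise disjoint. *)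

theory Defs
  imports Complex_Main
begin

record 'a hypergraph =
  vertices :: "'a set"
  hyperedges :: "'a set set"

definition finite_hypergraph :: "'a hypergraph \<Rightarrow> bool" where
  "finite_hypergraph H \<longleftrightarrow> finite (vertices H) \<and> (\<forall>e\<in>hyperedges H. e \<subseteq> vertices H)"

definition uniform_hypergraph :: "nat \<Rightarrow> 'a hypergraph \<Rightarrow> bool" where
  "uniform_hypergraph r H \<longleftrightarrow> finite_hypergraph H \<and> (\<forall>e\<in>hyperedges H. card e = r)"

definition linear_hypergraph :: "'a hypergraph \<Rightarrow> bool" where
  "linear_hypergraph H \<longleftrightarrow> finite_hypergraph H \<and>
     (\<forall>e\<in>hyperedges H. \<forall>f\<in>hyperedges H. e \<noteq> f \<longrightarrow> card (e \<inter> f) \<le> 1)"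

definition hdegree :: "'a hypergraph \<Rightarrow> 'a \<Rightarrow> nat" where
  "hdegree H v = card {e \<in> hyperedges H. v \<in> e}"

definition regular_hypergraph :: "nat \<Rightarrow> 'a hypergraph \<Rightarrow> bool" where
  "regular_hypergraph d H \<longleftrightarrow> (\<forall>v\<in>vertices H. hdegree H v = d)"

definition contains_hypergraph :: "'a hypergraph \<Rightarrow> 'b hypergraph \<Rightarrow> bool" where
  "contains_hypergraph H F \<longleftrightarrow>
     (\<exists>\<phi>. inj_on \<phi> (vertices F) \<and> \<phi> ` vertices F \<subseteq> vertices H \<and>
          (\<forall>e\<in>hyperedges F. \<phi> ` e \<in> hyperedges H))"

definition free_of :: "'b hypergraph \<Rightarrow> 'a hypergraph \<Rightarrow> bool" where
  "free_of F H \<longleftrightarrow> \<not> contains_hypergraph H F"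

text \<open>Every finite hypergraph is isomorphic to one whose vertices are natural numbers, so
  restricting to this vertex type loses no generality. There are at most \<open>2 ^ n\<close>
  hyperedges on \<open>n\<close> vertices, so the set is finite; it is nonempty whenever
  \<open>F\<close> has a hyperedge.\<close>

definition ex_lin :: "nat \<Rightarrow> nat \<Rightarrow> 'b hypergraph \<Rightarrow> nat" where
  "ex_lin r n F =
     Max {card (hyperedges H) | H :: nat hypergraph.
            uniform_hypergraph r H \<and> linear_hypergraph H \<and>
            card (vertices H) = n \<and> free_of F H}"

text \<open>A graph is regarded as a 2-uniform hypergraph. In the expansion, \<open>Inl v\<close> is
  the original vertex \<open>v\<close>, and \<open>Inr (e, i)\<close> with \<open>i < r - 2\<close> are the
  new vertices that enlarge the edge \<open>e\<close>.\<close>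

definition expanded_edge :: "nat \<Rightarrow> 'a set \<Rightarrow> ('a + 'a set \<times> nat) set" where
  "expanded_edge r e = Inl ` e \<union> (\<lambda>i. Inr (e, i)) ` {..<r - 2}"

definition expansion :: "nat \<Rightarrow> 'a hypergraph \<Rightarrow> ('a + 'a set \<times> nat) hypergraph" where
  "expansion r G =
     \<lparr>vertices = Inl ` vertices G \<union> Inr ` (hyperedges G \<times> {..<r - 2}),
      hyperedges = expanded_edge r ` hyperedges G\<rparr>"

definition star :: "nat \<Rightarrow> nat hypergraph" where
  "star k = \<lparr>vertices = {0..k}, hyperedges = (\<lambda>i. {0, i}) ` {1..k}\<rparr>"

end

theory Submission
  imports Defs
begin

text \<open>A linear uniform hypergraph contains \<open>S_k^r\<close> iff some vertex has degree at least \<open>k\<close>,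
  because by linearity any \<open>k\<close> hyperedges through a common vertex are otherwise disjoint. Hence
  being free means that all degrees are at most \<open>k - 1\<close>, and both the bound and its equality case
  follow from the degree sum \<open>r * |E|\<close>.\<close>

section \<open>Counting hyperedges and incidences\<close>

lemma finite_hyperedges:
  assumes "finite_hypergraph H"
  shows "finite (hyperedges H)"
proof (rule finite_subset)
  show "hyperedges H \<subseteq> Pow (vertices H)" "finite (Pow (vertices H))"
    using assms by (auto simp: finite_hypergraph_def)
qed

text \<open>A crude bound that makes the set under \<open>Max\<close> in \<open>ex_lin\<close>
  finite.\<close>

lemma card_hyperedges_le:
  assumes "finite_hypergraph H"
  shows "card (hyperedges H) \<le> 2 ^ card (vertices H)"
proof -
  have "card (hyperedges H) \<le> card (Pow (vertices H))"
    using assms by (intro card_mono) (auto simp: finite_hypergraph_def)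
  then show ?thesis
    using assms by (simp add: card_Pow finite_hypergraph_def)
qed

text \<open>Double counting of incident pairs of a vertex and a hyperedge: each hyperedge lies
  inside \<open>vertices H\<close>, so it accounts for exactly \<open>r\<close> of them.\<close>

lemma sum_hdegree:
  assumes "uniform_hypergraph r H"
  shows "(\<Sum>v\<in>vertices H. hdegree H v) = r * card (hyperedges H)"
  unfolding hdegree_def
proof (rule sum_multicount)
  have fin: "finite_hypergraph H"
    using assms by (simp add: uniform_hypergraph_def)
  show "finite (vertices H)" "finite (hyperedges H)"
    using fin finite_hyperedges by (auto simp: finite_hypergraph_def)
  show "\<forall>e\<in>hyperedges H. card {v \<in> vertices H. v \<in> e} = r"
  proof
    fix e assume e: "e \<in> hyperedges H"
    then have "{v \<in> vertices H. v \<in> e} = e"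
      using fin by (auto simp: finite_hypergraph_def)
    then show "card {v \<in> vertices H. v \<in> e} = r"
      using e assms by (simp add: uniform_hypergraph_def)
  qed
qed

section \<open>Expanded stars and vertex degrees\<close>

lemma Inl_in_expanded_edge [simp]: "Inl v \<in> expanded_edge r e \<longleftrightarrow> v \<in> e"
  by (auto simp: expanded_edge_def)

lemma expanded_edge_subset_vertices:
  assumes "e \<in> hyperedges G" "e \<subseteq> vertices G"
  shows "expanded_edge r e \<subseteq> vertices (expansion r G)"
  using assms by (auto simp: expanded_edge_def expansion_def)

text \<open>The image of the centre \<open>Inl 0\<close> is the required vertex: all
  \<open>k\<close> expanded edges pass through the centre, and an injective map keeps them
  distinct.\<close>

lemma contains_star_imp_hdegree:
  fixes H :: "'a hypergraph"
  assumes fin: "finite_hypergraph H"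
    and con: "contains_hypergraph H (expansion r (star k))"
  shows "\<exists>v\<in>vertices H. k \<le> hdegree H v"
proof -
  let ?F = "expansion r (star k)"
  obtain \<phi> where inj: "inj_on \<phi> (vertices ?F)"
    and V: "\<phi> ` vertices ?F \<subseteq> vertices H"
    and E: "\<And>e. e \<in> hyperedges ?F \<Longrightarrow> \<phi> ` e \<in> hyperedges H"
    using con by (auto simp: contains_hypergraph_def)
  define h where "h i = \<phi> ` expanded_edge r {0, i}" for i
  have sub: "expanded_edge r {0, i} \<subseteq> vertices ?F" if "i \<in> {1..k}" for i
    using that by (intro expanded_edge_subset_vertices) (auto simp: star_def)
  have "inj_on h {1..k}"
  proof (rule inj_onI)
    fix i j assume ij: "i \<in> {1..k}" "j \<in> {1..k}" and "h i = h j"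
    then have "expanded_edge r {0, i} = expanded_edge r {0, j}"
      unfolding h_def using inj_on_image_eq_iff[OF inj] sub by blast
    \<comment> \<open>The original vertices in an expanded edge are those of the star edge, so
      \<open>i\<close> lies in \<open>{0, j}\<close>; since \<open>i\<close> is at least 1, it is
      the leaf and not the centre.\<close>
    then have "Inl i \<in> expanded_edge r {0, j}"
      by (metis Inl_in_expanded_edge insertCI)
    then show "i = j" using ij by simp
  qed
  moreover have "h ` {1..k} \<subseteq> {e \<in> hyperedges H. \<phi> (Inl 0) \<in> e}"
    using E by (auto simp: h_def expansion_def star_def)
  ultimately have "card {1..k} \<le> hdegree H (\<phi> (Inl 0))"
    unfolding hdegree_def
    using finite_hyperedges[OF fin] by (intro card_inj_on_le) auto
  moreover have "\<phi> (Inl 0) \<in> vertices H"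
    using V by (auto simp: expansion_def star_def)
  ultimately show ?thesis by auto
qed

text \<open>Choose \<open>k\<close> hyperedges through \<open>v\<close>. By linearity they meet
  pairwise only in \<open>v\<close>, so the centre can go to \<open>v\<close> and the rest of each
  expanded edge onto the rest of its own hyperedge.\<close>

lemma hdegree_imp_contains_star:
  fixes H :: "'a hypergraph"
  assumes uni: "uniform_hypergraph r H" and lin: "linear_hypergraph H"
    and r: "r \<ge> 2" and v: "v \<in> vertices H" and deg: "k \<le> hdegree H v"
  shows "contains_hypergraph H (expansion r (star k))"
proof -
  let ?F = "expansion r (star k)"
  have fin: "finite_hypergraph H"
    using uni by (simp add: uniform_hypergraph_def)
  obtain T where T: "T \<subseteq> {e \<in> hyperedges H. v \<in> e}" "card T = k" "finite T"
    using deg unfolding hdegree_def by (rule obtain_subset_with_card_n)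
  obtain h where h: "bij_betw h {1..k} T"
    using T ex_bij_betw_nat_finite_1 by blast
  have hE: "h i \<in> hyperedges H" "v \<in> h i" if "i \<in> {1..k}" for i
    using bij_betw_apply[OF h that] T(1) by auto
  have hfin: "finite (h i)" if "i \<in> {1..k}" for i
    using hE(1)[OF that] fin unfolding finite_hypergraph_def by (blast intro: finite_subset)
  \<comment> \<open>The \<open>r - 1\<close> vertices of \<open>h i\<close> other than
    \<open>v\<close> are numbered: the indices below \<open>r - 2\<close> are for the new vertices
    of the expansion, the last index \<open>r - 2\<close> is for the leaf.\<close>
  have "\<exists>g. bij_betw g {..<r - 1} (h i - {v})" if "i \<in> {1..k}" for i
  proof (rule finite_same_card_bij)
    have "card (h i) = r"
      using hE(1)[OF that] uni by (simp add: uniform_hypergraph_def)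
    then show "finite (h i - {v})" "card {..<r - 1} = card (h i - {v})"
      using hE(2)[OF that] hfin[OF that] by simp_all
  qed simp
  then have "\<forall>i\<in>{1..k}. \<exists>g. bij_betw g {..<r - 1} (h i - {v})"
    by blast
  then obtain g where g: "\<And>i. i \<in> {1..k} \<Longrightarrow> bij_betw (g i) {..<r - 1} (h i - {v})"
    unfolding bchoice_iff by blast
  have gh: "g i j \<in> h i" "g i j \<noteq> v" if "i \<in> {1..k}" "j < r - 1" for i j
    using bij_betw_apply[OF g[OF that(1)], of j] that(2) by auto
  \<comment> \<open>Linearity enters here: a vertex \<open>g i j\<close> shared by two different
    chosen hyperedges would be a second common point besides \<open>v\<close>.\<close>
  have g_inj: "i = i' \<and> j = j'"
    if i: "i \<in> {1..k}" "i' \<in> {1..k}" and j: "j < r - 1" "j' < r - 1" and eq: "g i j = g i' j'"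
    for i i' j j'
  proof (rule conjI)
    show "i = i'"
    proof (rule ccontr)
      assume "i \<noteq> i'"
      then have "h i \<noteq> h i'"
        using inj_on_eq_iff[OF bij_betw_imp_inj_on[OF h]] i by blast
      then have "card (h i \<inter> h i') \<le> 1"
        using lin hE(1) i unfolding linear_hypergraph_def by blast
      moreover have "finite (h i \<inter> h i')"
        using hfin[OF i(1)] by blast
      moreover have "{v, g i j} \<subseteq> h i \<inter> h i'"
        using gh(1)[OF i(1) j(1)] gh(1)[OF i(2) j(2)] eq hE(2)[OF i(1)] hE(2)[OF i(2)] by simp
      ultimately have "card {v, g i j} \<le> 1"
        by (meson card_mono le_trans)
      then show False using gh(2)[OF i(1) j(1)] by simp
    qed
    then show "j = j'"
      using inj_on_eq_iff[OF bij_betw_imp_inj_on[OF g[OF i(1)]]] j eq by simp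
  qed
  text \<open>\<open>Max\<close> recovers the leaf \<open>i\<close> from the star edge \<open>{0, i}\<close>.\<close>
  define \<phi> where "\<phi> x = (case x of
      Inl i \<Rightarrow> (if i = 0 then v else g i (r - 2))
    | Inr (e, j) \<Rightarrow> g (Max e) j)" for x
  have \<phi>: "\<phi> (Inl 0) = v" "i \<noteq> 0 \<Longrightarrow> \<phi> (Inl i) = g i (r - 2)" "\<phi> (Inr ({0, i}, j)) = g i j"
    for i j
    by (auto simp: \<phi>_def)
  have vert: "x = Inl 0 \<or> (\<exists>i\<in>{1..k}. x = Inl i \<or> (\<exists>j<r - 2. x = Inr ({0, i}, j)))"
    if "x \<in> vertices ?F" for x
    using that by (fastforce simp: expansion_def star_def)
  have lt: "r - 2 < r - 1" "\<And>j. j < r - 2 \<Longrightarrow> j < r - 1"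
    using r by auto
  have img: "\<phi> ` expanded_edge r {0, i} = h i" if i: "i \<in> {1..k}" for i
  proof -
    \<comment> \<open>As \<open>r\<close> is at least 2, neither subtraction is truncated, and leaf
      and new vertices together use every index exactly once. Hence the image is all of
      \<open>h i\<close>.\<close>
    have "{..<r - 1} = insert (r - 2) {..<r - 2}"
      using r by auto
    then have "h i - {v} = insert (g i (r - 2)) (g i ` {..<r - 2})"
      using g[OF i] by (simp add: bij_betw_def)
    moreover have "\<phi> ` expanded_edge r {0, i}
        = insert v (insert (g i (r - 2)) (g i ` {..<r - 2}))"
      using i by (simp add: expanded_edge_def image_Un image_image \<phi>)
    ultimately show ?thesis
      using hE(2)[OF i] by auto
  qed
  have "inj_on \<phi> (vertices ?F)"
  proof (rule inj_onI)
    fix x y assume x: "x \<in> vertices ?F" and y: "y \<in> vertices ?F" and eq: "\<phi> x = \<phi> y"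
    \<comment> \<open>Every vertex other than the centre is encoded by a pair \<open>(i, j)\<close>
      with image \<open>g i j\<close>. Injectivity of \<open>\<phi>\<close> thus reduces to
      \<open>g_inj\<close>, and the centre is kept apart because \<open>g\<close> avoids
      \<open>v\<close>.\<close>
    have code: "x = Inl 0 \<and> \<phi> x = v \<or> (\<exists>i\<in>{1..k}. \<exists>j<r - 1. \<phi> x = g i j \<and>
        x = (if j = r - 2 then Inl i else Inr ({0, i}, j)))"
      if z: "x \<in> vertices ?F" for x
    proof -
      consider "x = Inl 0" | i where "i \<in> {1..k}" "x = Inl i"
        | i j where "i \<in> {1..k}" "j < r - 2" "x = Inr ({0, i}, j)"
        using vert[OF z] by blast
      then show ?thesis
      proof cases
        case 1
        then show ?thesis by (simp add: \<phi>)
      next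
        case (2 i)
        then show ?thesis
          using lt by (intro disjI2 bexI[of _ i] exI[of _ "r - 2"]) (auto simp: \<phi>)
      next
        case (3 i j)
        then show ?thesis
          using lt by (intro disjI2 bexI[of _ i] exI[of _ j]) (auto simp: \<phi>)
      qed
    qed
    show "x = y"
      using code[OF x]
    proof
      assume "x = Inl 0 \<and> \<phi> x = v"
      then show ?thesis
        using code[OF y] eq gh(2) by metis
    next
      assume "\<exists>i\<in>{1..k}. \<exists>j<r - 1. \<phi> x = g i j \<and>
        x = (if j = r - 2 then Inl i else Inr ({0, i}, j))"
      then obtain i j where ij: "i \<in> {1..k}" "j < r - 1" "\<phi> x = g i j"
        "x = (if j = r - 2 then Inl i else Inr ({0, i}, j))"
        by blast
      then obtain i' j' where ij': "i' \<in> {1..k}" "j' < r - 1" "\<phi> y = g i' j'"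
        "y = (if j' = r - 2 then Inl i' else Inr ({0, i'}, j'))"
        using code[OF y] eq gh(2)[OF ij(1,2)] by metis
      then show ?thesis
        using g_inj[OF ij(1) ij'(1) ij(2) ij'(2)] ij eq by metis
    qed
  qed
  moreover have "\<phi> ` vertices ?F \<subseteq> vertices H"
  proof -
    have "g i j \<in> vertices H" if "i \<in> {1..k}" "j < r - 1" for i j
      using gh(1)[OF that] hE(1)[OF that(1)] fin by (auto simp: finite_hypergraph_def)
    then show ?thesis
      using v lt by (auto dest!: vert simp: \<phi>)
  qed
  moreover have "\<forall>e\<in>hyperedges ?F. \<phi> ` e \<in> hyperedges H"
    using img hE by (auto simp: expansion_def star_def)
  ultimately show ?thesis
    by (auto simp: contains_hypergraph_def)
qed

text \<open>Both directions of the degree criterion, negated. With \<open>k\<close> at least 1 the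
  subtraction \<open>k - 1\<close> is genuine, so failing \<open>k \<le> d\<close> is the same as
  \<open>d \<le> k - 1\<close>.\<close>

lemma free_of_star_iff:
  assumes "uniform_hypergraph r H" "linear_hypergraph H" "r \<ge> 2" "k \<ge> 1"
  shows "free_of (expansion r (star k)) H \<longleftrightarrow> (\<forall>v\<in>vertices H. hdegree H v \<le> k - 1)"
proof -
  have "contains_hypergraph H (expansion r (star k)) \<longleftrightarrow> (\<exists>v\<in>vertices H. k \<le> hdegree H v)"
    using assms contains_star_imp_hdegree[of H r k] hdegree_imp_contains_star[of r H _ k]
    by (auto simp: uniform_hypergraph_def)
  then show ?thesis
    using \<open>k \<ge> 1\<close> unfolding free_of_def by (force simp: not_le)
qed

section \<open>The degree-sum bound, its equality case and the extremal number\<close>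

lemma card_hyperedges_star_free_le:
  assumes "uniform_hypergraph r H" "linear_hypergraph H" "r \<ge> 2" "k \<ge> 1"
    and "free_of (expansion r (star k)) H"
  shows "r * card (hyperedges H) \<le> card (vertices H) * (k - 1)"
proof -
  have "\<And>v. v \<in> vertices H \<Longrightarrow> hdegree H v \<le> k - 1"
    using free_of_star_iff[OF assms(1-4)] assms(5) by blast
  then show ?thesis
    using sum_bounded_above[of "vertices H" "hdegree H" "k - 1"]
    by (simp add: sum_hdegree[OF assms(1)])
qed

text \<open>In a free hypergraph each degree is at most \<open>k - 1\<close>; if the degree sum
  equals the sum of these bounds, no degree can fall short. Conversely, regularity gives both the
  degree bound and the sum.\<close>

lemma star_free_extremal_iff_regular:
  assumes "uniform_hypergraph r H" "linear_hypergraph H" "r \<ge> 2" "k \<ge> 1"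
  shows "free_of (expansion r (star k)) H \<and> r * card (hyperedges H) = card (vertices H) * (k - 1)
    \<longleftrightarrow> regular_hypergraph (k - 1) H"
proof
  assume reg: "regular_hypergraph (k - 1) H"
  then have "r * card (hyperedges H) = card (vertices H) * (k - 1)"
    unfolding sum_hdegree[OF assms(1), symmetric] by (simp add: regular_hypergraph_def)
  with reg show "free_of (expansion r (star k)) H
      \<and> r * card (hyperedges H) = card (vertices H) * (k - 1)"
    by (simp add: free_of_star_iff[OF assms] regular_hypergraph_def)
next
  assume *: "free_of (expansion r (star k)) H
      \<and> r * card (hyperedges H) = card (vertices H) * (k - 1)"
  then have le: "\<And>v. v \<in> vertices H \<Longrightarrow> hdegree H v \<le> k - 1"
    using free_of_star_iff[OF assms] by blast
  have "finite (vertices H)"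
    using assms(1) by (simp add: uniform_hypergraph_def finite_hypergraph_def)
  moreover have "(\<Sum>v\<in>vertices H. hdegree H v) = (\<Sum>v\<in>vertices H. k - 1)"
    using * by (simp add: sum_hdegree[OF assms(1)])
  ultimately show "regular_hypergraph (k - 1) H"
    unfolding regular_hypergraph_def using sum_mono_inv[of "hdegree H" _ "\<lambda>_. k - 1"] le by blast
qed

text \<open>\<open>Max\<close> is meaningful only on a finite nonempty set: the power set bound
  gives finiteness and \<open>H0\<close> is a member. Then the maximum is attained and dominates
  \<open>H0\<close>.\<close>

lemma ex_lin_props:
  fixes F :: "'b hypergraph"
  assumes "uniform_hypergraph r H0" "linear_hypergraph H0" "card (vertices H0) = n"
    "free_of F (H0 :: nat hypergraph)"
  shows ex_lin_attained: "\<exists>H :: nat hypergraph. uniform_hypergraph r H \<and> linear_hypergraph H \<and>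
      card (vertices H) = n \<and> free_of F H \<and> card (hyperedges H) = ex_lin r n F"
    and ex_lin_upper: "card (hyperedges H0) \<le> ex_lin r n F"
proof -
  let ?S = "{card (hyperedges H) | H :: nat hypergraph.
    uniform_hypergraph r H \<and> linear_hypergraph H \<and> card (vertices H) = n \<and> free_of F H}"
  have "?S \<subseteq> {..2 ^ n}"
    using card_hyperedges_le by (auto simp: uniform_hypergraph_def)
  then have fin: "finite ?S"
    using finite_subset by blast
  have mem: "card (hyperedges H0) \<in> ?S"
    using assms by blast
  then have "ex_lin r n F \<in> ?S"
    unfolding ex_lin_def using fin by (intro Max_in) blast+
  then show "\<exists>H :: nat hypergraph. uniform_hypergraph r H \<and> linear_hypergraph H \<and>
      card (vertices H) = n \<and> free_of F H \<and> card (hyperedges H) = ex_lin r n F"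
    by auto
  show "card (hyperedges H0) \<le> ex_lin r n F"
    unfolding ex_lin_def using fin mem by (rule Max_ge)
qed

theorem proposition1:
  fixes r k n :: nat
  assumes "r \<ge> 3" and "k \<ge> 1" and "n \<ge> 1"
  shows "real (ex_lin r n (expansion r (star k))) \<le> real n * real (k - 1) / real r
    \<and> (\<forall>H :: 'a hypergraph.
          uniform_hypergraph r H \<and> linear_hypergraph H \<and> card (vertices H) = n \<longrightarrow>
          (free_of (expansion r (star k)) H \<and>
             real (card (hyperedges H)) = real n * real (k - 1) / real r
           \<longleftrightarrow> regular_hypergraph (k - 1) H))
    \<and> (real (ex_lin r n (expansion r (star k))) = real n * real (k - 1) / real r
       \<longleftrightarrow> (\<exists>H :: nat hypergraph.
              uniform_hypergraph r H \<and> linear_hypergraph H \<and> card (vertices H) = n \<and>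
              regular_hypergraph (k - 1) H))"
proof -
  let ?F = "expansion r (star k)"
  have r2: "r \<ge> 2" using assms by simp
  \<comment> \<open>Clearing the positive denominator \<open>r\<close> turns the real statements
    into the natural-number form of the lemmas; \<open>of_nat_diff\<close> is disabled to keep
    \<open>real (k - 1)\<close> in one piece.\<close>
  have eq_iff: "real m = real n * real (k - 1) / real r \<longleftrightarrow> r * m = n * (k - 1)" for m
  proof -
    have "real m = real n * real (k - 1) / real r \<longleftrightarrow> real (r * m) = real (n * (k - 1))"
      using \<open>r \<ge> 3\<close> by (simp add: field_simps del: of_nat_diff)
    then show ?thesis by (simp only: of_nat_eq_iff)
  qed
  have le_iff: "real m \<le> real n * real (k - 1) / real r \<longleftrightarrow> r * m \<le> n * (k - 1)" for m
  proof -
    have "real m \<le> real n * real (k - 1) / real r \<longleftrightarrow> real (r * m) \<le> real (n * (k - 1))"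
      using \<open>r \<ge> 3\<close> by (simp add: field_simps del: of_nat_diff)
    then show ?thesis by (simp only: of_nat_le_iff)
  qed
  \<comment> \<open>The edgeless hypergraph has all degrees 0, hence is free; it shows that the
    maximum defining \<open>ex_lin\<close> is over a nonempty set.\<close>
  define H0 :: "nat hypergraph" where "H0 = \<lparr>vertices = {..<n}, hyperedges = {}\<rparr>"
  have H0: "uniform_hypergraph r H0" "linear_hypergraph H0" "card (vertices H0) = n"
    by (auto simp: H0_def uniform_hypergraph_def linear_hypergraph_def finite_hypergraph_def)
  have "free_of ?F H0"
    using free_of_star_iff[OF H0(1,2) r2 assms(2)] by (simp add: H0_def hdegree_def)
  from ex_lin_attained[OF H0 this] obtain M :: "nat hypergraph"
    where M: "uniform_hypergraph r M" "linear_hypergraph M" "card (vertices M) = n"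
      "free_of ?F M" "card (hyperedges M) = ex_lin r n ?F"
    by blast
  have bound: "r * ex_lin r n ?F \<le> n * (k - 1)"
    using card_hyperedges_star_free_le[OF M(1,2) r2 assms(2) M(4)] M by simp
  \<comment> \<open>If the bound is attained, the extremal \<open>M\<close> itself is regular.
    Conversely, a regular hypergraph is free and has enough hyperedges to push \<open>ex_lin\<close>
    up to the bound.\<close>
  have ex_iff: "r * ex_lin r n ?F = n * (k - 1) \<longleftrightarrow>
      (\<exists>H :: nat hypergraph. uniform_hypergraph r H \<and> linear_hypergraph H \<and>
        card (vertices H) = n \<and> regular_hypergraph (k - 1) H)"
  proof
    assume "r * ex_lin r n ?F = n * (k - 1)"
    then have "regular_hypergraph (k - 1) M"
      using star_free_extremal_iff_regular[OF M(1,2) r2 assms(2)] M by simp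
    then show "\<exists>H :: nat hypergraph. uniform_hypergraph r H \<and> linear_hypergraph H \<and>
        card (vertices H) = n \<and> regular_hypergraph (k - 1) H"
      using M by blast
  next
    assume "\<exists>H :: nat hypergraph. uniform_hypergraph r H \<and> linear_hypergraph H \<and>
        card (vertices H) = n \<and> regular_hypergraph (k - 1) H"
    then obtain H :: "nat hypergraph" where H: "uniform_hypergraph r H" "linear_hypergraph H"
      "card (vertices H) = n" "regular_hypergraph (k - 1) H"
      by blast
    then have "free_of ?F H" and card: "r * card (hyperedges H) = n * (k - 1)"
      using star_free_extremal_iff_regular[OF H(1,2) r2 assms(2)] by auto
    then have "card (hyperedges H) \<le> ex_lin r n ?F"
      using ex_lin_upper H by blast
    then have "n * (k - 1) \<le> r * ex_lin r n ?F"
      using card mult_le_mono2 by metis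
    with bound show "r * ex_lin r n ?F = n * (k - 1)" by simp
  qed
  show ?thesis
    \<comment> \<open>The middle claim concerns an arbitrary vertex type, so it comes directly from
      the polymorphic equality lemma and not from \<open>ex_lin\<close>, which ranges over vertices
      in \<open>nat\<close>.\<close>
    unfolding eq_iff le_iff
    using bound ex_iff star_free_extremal_iff_regular[OF _ _ r2 assms(2)] by blast
qed

end
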